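(* $\lambda_c(\mathbb{Z}^2)>2.48$.
   Context: Hard-core model on a finite graph $H$ at activity $\lambda>0$: the probability distribution on independent sets $I$ of $H$ with $\mu(I)\propto\lambda^{|I|}$; vertices in $I$ are occupied. For $L\ge1$ let $\Lambda_L=\{-L,\dots,L\}^2\subset\mathbb{Z}^2$ with the induced nearest-neighbour graph, and let $\partial\Lambda_L$ be its vertices with $\max(|x|,|y|)=L$. Let $p_L^{\mathrm{even}}$ (resp. $p_L^{\mathrm{odd}}$) be the probability that the origin is unoccupied in the hard-core model on $\Lambda_L$ conditioned on all vertices $(x,y)\in\partial\Lambda_L$ with $x+y$ even (resp. odd) being occupied. Uniqueness holds at $\lambda$ if $\lim_{L\to\infty}|p_L^{\mathrm{odd}}-p_L^{\mathrm{even}}|=0$. The critical activity $\lambda_c(\mathbb{Z}^2)$ is the supremum of those $\lambda>0$ such that uniqueness holds at every activity in $(0,\lambda]$. *)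

theory Defs
  imports "HOL-Probability.Probability"
begin

text \<open>
  A finite graph is given by a finite vertex set \<open>V\<close> and an adjacency relation \<open>adj\<close>; only the
  restriction of \<open>adj\<close> to \<open>V\<close> matters, so restricting \<open>V\<close> yields the induced subgraph.
\<close>

definition independent_sets :: "'a set \<Rightarrow> ('a \<Rightarrow> 'a \<Rightarrow> bool) \<Rightarrow> 'a set set" where
  "independent_sets V adj = {I. I \<subseteq> V \<and> (\<forall>u\<in>I. \<forall>v\<in>I. \<not> adj u v)}"

definition partition_function :: "'a set \<Rightarrow> ('a \<Rightarrow> 'a \<Rightarrow> bool) \<Rightarrow> real \<Rightarrow> real" where
  "partition_function V adj lam = (\<Sum>I\<in>independent_sets V adj. lam ^ card I)"

text \<open>
  Meaningful for finite \<open>V\<close> and \<open>lam > 0\<close>; \<open>pmf_hard_core\<close> below shows that under these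
  assumptions the given weights do form a probability mass function.
\<close>

definition hard_core :: "'a set \<Rightarrow> ('a \<Rightarrow> 'a \<Rightarrow> bool) \<Rightarrow> real \<Rightarrow> 'a set pmf" where
  "hard_core V adj lam = embed_pmf (\<lambda>I. if I \<in> independent_sets V adj
     then lam ^ card I / partition_function V adj lam else 0)"

lemma finite_independent_sets: "finite V \<Longrightarrow> finite (independent_sets V adj)"
  by (rule finite_subset[of _ "Pow V"]) (auto simp: independent_sets_def)

lemma partition_function_pos:
  assumes "finite V" "lam > 0"
  shows "partition_function V adj lam > 0"
  unfolding partition_function_def
proof (rule sum_pos)
  show "finite (independent_sets V adj)"
    using assms by (simp add: finite_independent_sets)
  have "{} \<in> independent_sets V adj"
    by (simp add: independent_sets_def)
  then show "independent_sets V adj \<noteq> {}"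
    by blast
qed (use assms in simp)

lemma pmf_hard_core:
  assumes "finite V" "lam > 0"
  shows "pmf (hard_core V adj lam) I =
    (if I \<in> independent_sets V adj then lam ^ card I / partition_function V adj lam else 0)"
  unfolding hard_core_def
proof (rule pmf_embed_pmf)
  let ?S = "independent_sets V adj" and ?Z = "partition_function V adj lam"
  let ?f = "\<lambda>I. if I \<in> ?S then lam ^ card I / ?Z else 0"
  have Z: "?Z > 0"
    using assms by (rule partition_function_pos)
  show nonneg: "0 \<le> ?f J" for J
    using Z assms by simp
  have fin: "finite ?S"
    using assms by (simp add: finite_independent_sets)
  have "(\<integral>\<^sup>+J. ennreal (?f J) \<partial>count_space UNIV) = (\<Sum>J\<in>?S. ennreal (?f J))"
    by (rule nn_integral_count_space'[OF fin]) auto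
  also have "\<dots> = ennreal (\<Sum>J\<in>?S. ?f J)"
    using nonneg by (rule sum_ennreal)
  also have "(\<Sum>J\<in>?S. ?f J) = (\<Sum>J\<in>?S. lam ^ card J / ?Z)"
    by (rule sum.cong) auto
  also have "\<dots> = 1"
    using Z by (simp add: partition_function_def flip: sum_divide_distrib)
  finally show "(\<integral>\<^sup>+J. ennreal (?f J) \<partial>count_space UNIV) = 1"
    by simp
qed

definition lattice_adj :: "int \<times> int \<Rightarrow> int \<times> int \<Rightarrow> bool" where
  "lattice_adj u v \<longleftrightarrow> \<bar>fst u - fst v\<bar> + \<bar>snd u - snd v\<bar> = 1"

definition lattice_box :: "nat \<Rightarrow> (int \<times> int) set" where
  "lattice_box L = {- int L..int L} \<times> {- int L..int L}"

definition lattice_box_boundary :: "nat \<Rightarrow> (int \<times> int) set" where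
  "lattice_box_boundary L = {(x, y) \<in> lattice_box L. max \<bar>x\<bar> \<bar>y\<bar> = int L}"

definition unoccupied_prob :: "real \<Rightarrow> nat \<Rightarrow> (int \<times> int) set \<Rightarrow> real" where
  "unoccupied_prob lam L B =
     \<P>(I in measure_pmf (hard_core (lattice_box L) lattice_adj lam). (0, 0) \<notin> I \<bar> B \<subseteq> I)"

definition p_even :: "real \<Rightarrow> nat \<Rightarrow> real" where
  "p_even lam L = unoccupied_prob lam L {(x, y) \<in> lattice_box_boundary L. even (x + y)}"

definition p_odd :: "real \<Rightarrow> nat \<Rightarrow> real" where
  "p_odd lam L = unoccupied_prob lam L {(x, y) \<in> lattice_box_boundary L. odd (x + y)}"

definition uniqueness :: "real \<Rightarrow> bool" where
  "uniqueness lam \<longleftrightarrow> (\<lambda>L. \<bar>p_odd lam L - p_even lam L\<bar>) \<longlonglongrightarrow> 0"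

text \<open>
  The supremum is taken in the extended reals, so that it is well defined without presupposing
  that the set is bounded above.
\<close>

definition critical_activity :: ereal where
  "critical_activity = Sup (ereal ` {lam. lam > 0 \<and> (\<forall>lam'\<in>{0<..lam}. uniqueness lam')})"

end

theory Submission
  imports Defs
begin

text \<open>
  For a finite set \<open>V\<close> of vertices let \<open>q V v = Z V / Z (V - {v})\<close>, the inverse of the probability
  that \<open>v\<close> is unoccupied. Deleting the neighbours \<open>u\<^sub>1, u\<^sub>2, \<dots>\<close> of \<open>v\<close> one after the other gives
  the exact recursion \<open>q V v = 1 + lam * (\<Prod>i. 1 / q (V - {v, u\<^sub>1, \<dots>, u\<^sub>i\<^sub>-\<^sub>1}) u\<^sub>i)\<close>,
  in which the exploration remembers the vertices it has deleted, and so never closes short cycles.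
  Along the recursion only the deleted vertices close to the current one are remembered, which leaves
  finitely many shapes. A template \<open>t\<close> is a shape with a potential \<open>ln (a\<^sub>t * q - b\<^sub>t) / a\<^sub>t\<close>. By the mean value
  theorem a step of the recursion contracts the potentials by the factor \<open>\<rho>\<close> as soon as
  \<open>lam * (\<Prod>i. z\<^sub>i) * ((\<Sum>i. a\<^sub>i - b\<^sub>i * z\<^sub>i) - \<rho> * a\<^sub>t) \<le> \<rho> * (a\<^sub>t - b\<^sub>t)\<close> for all
  \<open>z\<^sub>i = 1 / q\<^sub>i\<close>, where the sum and the product range over the neighbours. By AM-GM this follows
  from one numerical inequality per template, and an explicit table of nineteen templates satisfies
  all of them at \<open>lam = 2.481\<close>. The two boundary conditions give sets that agree near the origin, so
  the influence of the boundary decays exponentially for all \<open>lam \<le> 2.481\<close>.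
\<close>

subsection \<open>Contraction of the potentials\<close>

text \<open>
  The antiderivative in \<open>ln q\<close> of \<open>1 / (a - b / q)\<close>, so that a change of the potential at unit speed
  changes \<open>ln q\<close> at speed \<open>a - b / q\<close>.
\<close>

definition potential :: "real \<Rightarrow> real \<Rightarrow> real \<Rightarrow> real" where
  "potential a b q = ln (a * q - b) / a"

text \<open>This is AM-GM for the numbers \<open>\<beta> i * z i\<close> together with \<open>E - (\<Sum>i\<in>I. \<beta> i * z i)\<close>.\<close>

lemma mult_prod_weighted_bound:
  fixes \<beta> z :: "'i \<Rightarrow> real"
  assumes fin: "finite I" and lam: "lam \<ge> 0" and d: "d \<ge> 0"
    and \<beta>: "\<And>i. i \<in> I \<Longrightarrow> \<beta> i > 0" and z: "\<And>i. i \<in> I \<Longrightarrow> z i \<ge> 0"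
    and bound: "lam * E ^ Suc (card I) \<le> real (Suc (card I)) ^ Suc (card I) * d * prod \<beta> I"
  shows "lam * prod z I * (E - (\<Sum>i\<in>I. \<beta> i * z i)) \<le> d"
proof (cases "E - (\<Sum>i\<in>I. \<beta> i * z i) \<le> 0")
  case True
  have "lam * prod z I \<ge> 0"
    using lam z by (simp add: prod_nonneg)
  with True have "lam * prod z I * (E - (\<Sum>i\<in>I. \<beta> i * z i)) \<le> 0"
    by (rule mult_nonneg_nonpos[rotated])
  with d show ?thesis
    by linarith
next
  case False
  \<comment> \<open>With \<open>m\<close> the mean of the \<open>n\<close> numbers,
    \<open>x / m \<le> exp (x / m - 1)\<close> is applied to each of them. The exponents add up to
    \<open>E / m - n = 0\<close>, so the product of the normalised numbers is at most 1.\<close>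
  define n where "n = Suc (card I)"
  define t where "t = E - (\<Sum>i\<in>I. \<beta> i * z i)"
  define m where "m = E / n"
  have t: "t > 0" using False by (simp add: t_def)
  have "(\<Sum>i\<in>I. \<beta> i * z i) \<ge> 0"
    using \<beta> z by (intro sum_nonneg mult_nonneg_nonneg) (auto intro: less_imp_le)
  then have E: "E > 0" using t by (simp add: t_def)
  then have m: "m > 0" by (simp add: m_def n_def)
  have le_exp: "x / m \<le> exp (x / m - 1)" for x
    using exp_ge_add_one_self[of "x / m - 1"] by simp
  have "t / m * (\<Prod>i\<in>I. \<beta> i * z i / m) \<le> exp (t / m - 1) * (\<Prod>i\<in>I. exp (\<beta> i * z i / m - 1))"
    using t m \<beta> z le_exp
    by (intro mult_mono prod_mono prod_nonneg conjI) (auto simp: less_imp_le)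
  also have "\<dots> = exp ((t + (\<Sum>i\<in>I. \<beta> i * z i)) / m - n)"
    using fin by (simp add: exp_sum[symmetric] mult_exp_exp sum_subtractf sum_divide_distrib[symmetric]
        n_def add_divide_distrib algebra_simps)
  also have "t + (\<Sum>i\<in>I. \<beta> i * z i) = E" by (simp add: t_def)
  also have "E / m = n" using E by (simp add: m_def n_def)
  finally have "t / m * (\<Prod>i\<in>I. \<beta> i * z i / m) \<le> 1" by simp
  then have "t * (prod \<beta> I * prod z I) / m ^ n \<le> 1"
    by (simp add: prod.distrib prod_dividef n_def)
  then have "t * (prod \<beta> I * prod z I) \<le> m ^ n"
    using m by (simp add: pos_divide_le_eq)
  then have "t * (prod \<beta> I * prod z I) * real n ^ n \<le> E ^ n"
    by (simp add: m_def n_def power_divide pos_le_divide_eq del: power_Suc of_nat_Suc)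
  then have "lam * (t * (prod \<beta> I * prod z I) * real n ^ n) \<le> lam * E ^ n"
    using lam by (rule mult_left_mono)
  also have "\<dots> \<le> real n ^ n * d * prod \<beta> I"
    using bound by (simp add: n_def)
  finally have "(lam * prod z I * t) * (prod \<beta> I * real n ^ n) \<le> d * (prod \<beta> I * real n ^ n)"
    by (simp add: algebra_simps)
  moreover have "prod \<beta> I * real n ^ n > 0"
    using \<beta> by (simp add: prod_pos n_def del: power_Suc of_nat_Suc)
  ultimately show ?thesis
    unfolding t_def by (rule mult_right_le_imp_le)
qed

text \<open>The families \<open>q\<close> and \<open>q'\<close> are joined by a path that is linear
  in the potentials rather than in the ratios, so each potential moves at speed at most
  \<open>D\<close>. The mean value theorem then reduces the claim to a pointwise bound on the
  derivative of the new potential.\<close>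

lemma potential_contraction:
  fixes \<alpha> \<beta> q q' :: "'i \<Rightarrow> real"
  assumes fin: "finite I" and lam: "lam > 0" and ab: "0 \<le> b" "b < a" and \<rho>: "\<rho> \<ge> 0"
    and \<alpha>\<beta>: "\<And>i. i \<in> I \<Longrightarrow> 0 < \<beta> i \<and> \<beta> i < \<alpha> i"
    and q: "\<And>i. i \<in> I \<Longrightarrow> q i \<ge> 1" and q': "\<And>i. i \<in> I \<Longrightarrow> q' i \<ge> 1"
    and D: "\<And>i. i \<in> I \<Longrightarrow> \<bar>potential (\<alpha> i) (\<beta> i) (q i) - potential (\<alpha> i) (\<beta> i) (q' i)\<bar> \<le> D"
    and "D \<ge> 0"
    and bound: "lam * (sum \<alpha> I - \<rho> * a) ^ Suc (card I)
      \<le> real (Suc (card I)) ^ Suc (card I) * (\<rho> * (a - b)) * prod \<beta> I"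
  shows "\<bar>potential a b (1 + lam * (\<Prod>i\<in>I. 1 / q i)) - potential a b (1 + lam * (\<Prod>i\<in>I. 1 / q' i))\<bar>
    \<le> \<rho> * D"
proof -
  define \<phi> \<phi>' where "\<phi> = (\<lambda>i. potential (\<alpha> i) (\<beta> i) (q i))"
    and "\<phi>' = (\<lambda>i. potential (\<alpha> i) (\<beta> i) (q' i))"
  define u where "u = (\<lambda>i s. (1 - s) * \<phi> i + s * \<phi>' i)"
  \<comment> \<open>\<open>Q i s\<close> is the ratio whose potential is
    \<open>u i s\<close>.\<close>
  define Q where "Q = (\<lambda>i s. (exp (\<alpha> i * u i s) + \<beta> i) / \<alpha> i)"
  define L where "L = (\<lambda>s. \<Sum>i\<in>I. ln (Q i s))"
  define F where "F = (\<lambda>s. potential a b (1 + lam * exp (- L s)))"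
  have \<alpha>_pos: "\<alpha> i > 0" if "i \<in> I" for i
    using \<alpha>\<beta>[OF that] by linarith
  have exp_potential: "exp (\<alpha> i * potential (\<alpha> i) (\<beta> i) x) = \<alpha> i * x - \<beta> i" if "i \<in> I" "x \<ge> 1" for i x
  proof -
    have "\<alpha> i * x \<ge> \<alpha> i"
      using that \<alpha>_pos[of i] by simp
    then have "\<alpha> i * x - \<beta> i > 0"
      using \<alpha>\<beta>[OF that(1)] by linarith
    then show ?thesis
      using \<alpha>_pos[OF that(1)] by (simp add: potential_def)
  qed
  have potential_ge: "potential (\<alpha> i) (\<beta> i) x \<ge> ln (\<alpha> i - \<beta> i) / \<alpha> i" if "i \<in> I" "x \<ge> 1" for i x
  proof -
    have "\<alpha> i * x \<ge> \<alpha> i"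
      using that \<alpha>_pos[of i] by simp
    then have "ln (\<alpha> i - \<beta> i) \<le> ln (\<alpha> i * x - \<beta> i)"
      using \<alpha>\<beta>[OF that(1)] by (intro ln_mono) auto
    then show ?thesis
      using \<alpha>_pos[OF that(1)] by (simp add: potential_def divide_right_mono)
  qed
  \<comment> \<open>On ratios at least 1 the potential is bounded below by its value at 1, and
    convex combinations keep this bound.\<close>
  have Q_ge: "Q i s \<ge> 1" if i: "i \<in> I" and s: "0 \<le> s" "s \<le> 1" for i s
  proof -
    have "u i s \<ge> (1 - s) * (ln (\<alpha> i - \<beta> i) / \<alpha> i) + s * (ln (\<alpha> i - \<beta> i) / \<alpha> i)"
      unfolding u_def \<phi>_def \<phi>'_def using s potential_ge[OF i] q[OF i] q'[OF i]
      by (intro add_mono mult_left_mono) auto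
    then have "u i s \<ge> ln (\<alpha> i - \<beta> i) / \<alpha> i"
      by (simp only: distrib_right[symmetric]) simp
    then have "ln (\<alpha> i - \<beta> i) \<le> \<alpha> i * u i s"
      using \<alpha>_pos[OF i] by (simp add: pos_divide_le_eq mult.commute)
    then have "exp (ln (\<alpha> i - \<beta> i)) \<le> exp (\<alpha> i * u i s)"
      by (simp only: exp_le_cancel_iff)
    then show ?thesis
      using \<alpha>\<beta>[OF i] \<alpha>_pos[OF i] by (simp add: Q_def)
  qed
  have Q0: "Q i 0 = q i" and Q1: "Q i 1 = q' i" if i: "i \<in> I" for i
    using exp_potential[OF i q[OF i]] exp_potential[OF i q'[OF i]] \<alpha>_pos[OF i]
    by (auto simp: Q_def u_def \<phi>_def \<phi>'_def)
  have exp_L: "exp (- L s) = (\<Prod>i\<in>I. 1 / Q i s)" if "\<And>i. i \<in> I \<Longrightarrow> Q i s \<ge> 1" for s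
  proof -
    have "exp (- L s) = (\<Prod>i\<in>I. exp (- ln (Q i s)))"
      using fin by (simp add: L_def sum_negf[symmetric] exp_sum)
    also have "\<dots> = (\<Prod>i\<in>I. 1 / Q i s)"
    proof (rule prod.cong)
      fix i assume "i \<in> I"
      then show "exp (- ln (Q i s)) = 1 / Q i s"
        using that[of i] by (simp add: exp_minus inverse_eq_divide)
    qed simp
    finally show ?thesis .
  qed
  define L' where "L' = (\<lambda>s. \<Sum>i\<in>I. (\<alpha> i - \<beta> i / Q i s) * (\<phi>' i - \<phi> i))"
  define F' where "F' = (\<lambda>s. lam * exp (- L s) * (- L' s) / (a * (1 + lam * exp (- L s)) - b))"
  have denom: "a * (1 + lam * exp x) - b > 0" for x :: real
  proof -
    have "a * (lam * exp x) \<ge> 0"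
      using ab lam by simp
    then show ?thesis
      using ab unfolding distrib_left by linarith
  qed
  have L_deriv: "(L has_real_derivative L' s) (at s)" if s: "0 \<le> s" "s \<le> 1" for s
    unfolding L_def L'_def
  proof (rule DERIV_sum)
    fix i assume i: "i \<in> I"
    have "(Q i has_real_derivative exp (\<alpha> i * u i s) * (\<phi>' i - \<phi> i)) (at s)"
      unfolding Q_def u_def using \<alpha>_pos[OF i]
      by (auto intro!: derivative_eq_intros simp: field_simps)
    moreover have "exp (\<alpha> i * u i s) = \<alpha> i * Q i s - \<beta> i"
      using \<alpha>_pos[OF i] by (simp add: Q_def)
    ultimately have Q': "(Q i has_real_derivative (\<alpha> i * Q i s - \<beta> i) * (\<phi>' i - \<phi> i)) (at s)"
      by simp
    show "((\<lambda>s. ln (Q i s)) has_real_derivative (\<alpha> i - \<beta> i / Q i s) * (\<phi>' i - \<phi> i)) (at s)"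
      using Q_ge[OF i s] by (auto intro!: derivative_eq_intros Q' simp: field_simps)
  qed
  have F_deriv: "(F has_real_derivative F' s) (at s)" if s: "0 \<le> s" "s \<le> 1" for s
  proof -
    have "((\<lambda>s. a * (1 + lam * exp (- L s)) - b) has_real_derivative
        a * (lam * exp (- L s) * (- L' s))) (at s)"
      by (auto intro!: derivative_eq_intros L_deriv[OF s])
    from DERIV_cdivide[OF DERIV_chain2[OF DERIV_ln_divide[OF denom] this], of a]
    show ?thesis
      using ab by (simp add: F_def F'_def potential_def)
  qed
  have F'_bound: "\<bar>F' s\<bar> \<le> \<rho> * D" if s: "0 \<le> s" "s \<le> 1" for s
  proof -
    define z where "z = (\<lambda>i. 1 / Q i s)"
    have z: "0 < z i" "z i \<le> 1" if "i \<in> I" for i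
      using Q_ge[OF that s] by (auto simp: z_def)
    have weight: "\<alpha> i - \<beta> i * z i \<ge> 0" if "i \<in> I" for i
    proof -
      have "\<beta> i * z i \<le> \<beta> i * 1"
        using z[OF that] \<alpha>\<beta>[OF that] by (intro mult_left_mono) auto
      then show ?thesis using \<alpha>\<beta>[OF that] by linarith
    qed
    have eL: "exp (- L s) = prod z I"
      using exp_L[of s] Q_ge s by (simp add: z_def)
    have "\<bar>L' s\<bar> \<le> (\<Sum>i\<in>I. \<bar>(\<alpha> i - \<beta> i * z i) * (\<phi>' i - \<phi> i)\<bar>)"
      unfolding L'_def z_def by (rule order_trans[OF sum_abs]) simp
    also have "\<dots> \<le> (\<Sum>i\<in>I. (\<alpha> i - \<beta> i * z i) * D)"
      using D weight by (intro sum_mono) (auto simp: abs_mult \<phi>_def \<phi>'_def abs_minus_commute intro!: mult_left_mono)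
    also have "\<dots> = (\<Sum>i\<in>I. \<alpha> i - \<beta> i * z i) * D"
      by (simp add: sum_distrib_right)
    finally have L'_le: "\<bar>L' s\<bar> \<le> (\<Sum>i\<in>I. \<alpha> i - \<beta> i * z i) * D" .
    \<comment> \<open>The desired bound has a denominator
      \<open>a * (1 + lam * prod z I) - b\<close>. Its part proportional to
      \<open>lam * prod z I\<close> is moved to the left, into \<open>E\<close>, and
      \<open>\<rho> * (a - b)\<close> remains as \<open>d\<close>.\<close>
    have "lam * prod z I * ((sum \<alpha> I - \<rho> * a) - (\<Sum>i\<in>I. \<beta> i * z i)) \<le> \<rho> * (a - b)"
      using lam \<rho> ab \<alpha>\<beta> z by (intro mult_prod_weighted_bound fin bound) (auto intro: less_imp_le)
    then have step: "lam * prod z I * (\<Sum>i\<in>I. \<alpha> i - \<beta> i * z i) \<le> \<rho> * (a * (1 + lam * prod z I) - b)"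
      by (simp add: sum_subtractf algebra_simps)
    have "lam * prod z I * \<bar>L' s\<bar> \<le> lam * prod z I * ((\<Sum>i\<in>I. \<alpha> i - \<beta> i * z i) * D)"
      using L'_le lam z by (intro mult_left_mono mult_nonneg_nonneg prod_nonneg) (auto simp: less_imp_le)
    also have "\<dots> \<le> \<rho> * (a * (1 + lam * prod z I) - b) * D"
      using mult_right_mono[OF step \<open>D \<ge> 0\<close>] by (simp add: mult.assoc)
    finally have "lam * prod z I * \<bar>L' s\<bar> \<le> (\<rho> * D) * (a * (1 + lam * prod z I) - b)"
      by (simp add: mult_ac)
    moreover have "\<bar>F' s\<bar> = lam * prod z I * \<bar>L' s\<bar> / (a * (1 + lam * prod z I) - b)"
      using denom[of "- L s"] lam z
      by (simp add: F'_def abs_mult eL[symmetric])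
    ultimately show ?thesis
      using denom[of "- L s"] by (simp add: eL pos_divide_le_eq)
  qed
  obtain s where "0 < s" "s < 1" "F 1 - F 0 = (1 - 0) * F' s"
    using MVT2[of 0 1 F F'] F_deriv by auto
  then have "\<bar>F 0 - F 1\<bar> \<le> \<rho> * D"
    using F'_bound[of s] by (simp add: abs_minus_commute)
  moreover have "F 0 = potential a b (1 + lam * (\<Prod>i\<in>I. 1 / q i))"
    using exp_L[of 0] q Q0 by (simp add: F_def)
  moreover have "F 1 = potential a b (1 + lam * (\<Prod>i\<in>I. 1 / q' i))"
    using exp_L[of 1] q' Q1 by (simp add: F_def)
  ultimately show ?thesis
    by simp
qed

subsection \<open>The deletion recursion for the hard-core model\<close>

lemma independent_sets_mono: "V \<subseteq> W \<Longrightarrow> independent_sets V adj \<subseteq> independent_sets W adj"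
  by (auto simp: independent_sets_def)

lemma partition_function_mono:
  assumes "finite W" "V \<subseteq> W" "lam > 0"
  shows "partition_function V adj lam \<le> partition_function W adj lam"
  unfolding partition_function_def using assms
  by (intro sum_mono2 finite_independent_sets independent_sets_mono) auto

text \<open>Occupied vertices block their neighbours, so \<open>J \<mapsto> B \<union> J\<close> is
  a bijection from the independent sets of what is left.\<close>

lemma sum_independent_sets_containing:
  assumes fin: "finite V" and sym: "symp adj" and B: "B \<in> independent_sets V adj"
  shows "(\<Sum>I | I \<in> independent_sets V adj \<and> B \<subseteq> I. lam ^ card I)
    = lam ^ card B * partition_function (V - B - {u. \<exists>b\<in>B. adj b u}) adj lam"
proof -
  define W where "W = V - B - {u. \<exists>b\<in>B. adj b u}"
  have finB: "finite B"
    using B fin by (auto simp: independent_sets_def intro: finite_subset)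
  have bij: "bij_betw (\<lambda>J. B \<union> J) (independent_sets W adj) {I \<in> independent_sets V adj. B \<subseteq> I}"
  proof (rule bij_betw_byWitness[where f' = "\<lambda>I. I - B"])
    show "(\<lambda>J. B \<union> J) ` independent_sets W adj \<subseteq> {I \<in> independent_sets V adj. B \<subseteq> I}"
    proof safe
      fix J assume J: "J \<in> independent_sets W adj"
      have "\<not> adj u w" if "u \<in> B \<union> J" "w \<in> B \<union> J" for u w
        using that B J sympD[OF sym, of u w] unfolding independent_sets_def W_def by blast
      then show "B \<union> J \<in> independent_sets V adj"
        using B J by (auto simp: independent_sets_def W_def)
    qed
    show "(\<lambda>I. I - B) ` {I \<in> independent_sets V adj. B \<subseteq> I} \<subseteq> independent_sets W adj"
      unfolding independent_sets_def W_def by blast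
  qed (auto simp: independent_sets_def W_def)
  have "(\<Sum>I | I \<in> independent_sets V adj \<and> B \<subseteq> I. lam ^ card I)
    = (\<Sum>J\<in>independent_sets W adj. lam ^ card (B \<union> J))"
    using sum.reindex_bij_betw[OF bij, of "\<lambda>I. lam ^ card I"] by simp
  also have "\<dots> = (\<Sum>J\<in>independent_sets W adj. lam ^ card B * lam ^ card J)"
  proof (rule sum.cong)
    fix J assume "J \<in> independent_sets W adj"
    then have "J \<subseteq> W"
      by (simp add: independent_sets_def)
    then have "finite J" "B \<inter> J = {}"
      using fin by (auto simp: W_def intro: finite_subset)
    then show "lam ^ card (B \<union> J) = lam ^ card B * lam ^ card J"
      using finB by (simp add: card_Un_disjoint power_add)
  qed simp
  finally show ?thesis
    by (simp add: partition_function_def W_def sum_distrib_left)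
qed

lemma partition_function_remove:
  assumes fin: "finite V" and sym: "symp adj" and "irreflp adj" and v: "v \<in> V"
  shows "partition_function V adj lam
    = partition_function (V - {v}) adj lam + lam * partition_function (V - {v} - {u. adj v u}) adj lam"
proof -
  have "partition_function V adj lam
    = (\<Sum>I | I \<in> independent_sets V adj \<and> v \<notin> I. lam ^ card I)
      + (\<Sum>I | I \<in> independent_sets V adj \<and> {v} \<subseteq> I. lam ^ card I)"
    unfolding partition_function_def using finite_independent_sets[OF fin]
    by (subst sum.union_disjoint[symmetric]) (auto intro!: sum.cong)
  also have "{I. I \<in> independent_sets V adj \<and> v \<notin> I} = independent_sets (V - {v}) adj"
    by (auto simp: independent_sets_def)
  also have "(\<Sum>I | I \<in> independent_sets V adj \<and> {v} \<subseteq> I. lam ^ card I)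
    = lam * partition_function (V - {v} - {u. adj v u}) adj lam"
    using v \<open>irreflp adj\<close>
    by (subst sum_independent_sets_containing[OF fin sym]) (auto simp: independent_sets_def irreflp_def)
  finally show ?thesis
    by (simp add: partition_function_def)
qed

definition removal_ratio :: "('a \<Rightarrow> 'a \<Rightarrow> bool) \<Rightarrow> real \<Rightarrow> 'a set \<Rightarrow> 'a \<Rightarrow> real" where
  "removal_ratio adj lam V v = partition_function V adj lam / partition_function (V - {v}) adj lam"

lemma removal_ratio_not_in:
  assumes "finite V" "lam > 0" "v \<notin> V"
  shows "removal_ratio adj lam V v = 1"
  using assms partition_function_pos[of V lam adj] by (simp add: removal_ratio_def)

lemma removal_ratio_ge_1:
  assumes "finite V" "lam > 0"
  shows "removal_ratio adj lam V v \<ge> 1"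
  using assms partition_function_pos[of "V - {v}" lam adj] partition_function_mono[of V "V - {v}" lam adj]
  by (simp add: removal_ratio_def le_divide_eq_1)

text \<open>The product telescopes.\<close>

lemma prod_removal_ratio:
  assumes fin: "finite V" and lam: "lam > 0" and k: "k \<le> length us"
  shows "(\<Prod>i<k. 1 / removal_ratio adj lam (V - set (take i us)) (us ! i))
    = partition_function (V - set (take k us)) adj lam / partition_function V adj lam"
  using k
proof (induction k)
  case 0
  then show ?case
    using partition_function_pos[OF fin lam, of adj] by simp
next
  case (Suc k)
  have "V - set (take k us) - {us ! k} = V - set (take (Suc k) us)"
    using Suc.prems by (auto simp: take_Suc_conv_app_nth)
  then show ?case
    using Suc partition_function_pos[of "V - set (take k us)" lam adj] fin lam
    by (simp add: removal_ratio_def)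
qed

text \<open>The list \<open>us\<close> may contain neighbours already missing from \<open>V\<close>:
  their ratio is 1. Hence one list, fixed by a template, serves every \<open>V\<close>.\<close>

lemma removal_ratio_rec:
  assumes fin: "finite V" and lam: "lam > 0" and "symp adj" "irreflp adj" and v: "v \<in> V"
    and us: "set us \<subseteq> {u. adj v u}" "{u \<in> V. adj v u} \<subseteq> set us"
  shows "removal_ratio adj lam V v
    = 1 + lam * (\<Prod>i<length us. 1 / removal_ratio adj lam (V - {v} - set (take i us)) (us ! i))"
proof -
  have "V - {v} - set us = V - {v} - {u. adj v u}"
    using us by auto
  then have "(\<Prod>i<length us. 1 / removal_ratio adj lam (V - {v} - set (take i us)) (us ! i))
    = partition_function (V - {v} - {u. adj v u}) adj lam / partition_function (V - {v}) adj lam"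
    using prod_removal_ratio[of "V - {v}" lam "length us" us adj] fin lam by simp
  moreover have "partition_function (V - {v}) adj lam > 0"
    using fin lam by (simp add: partition_function_pos)
  ultimately show ?thesis
    using partition_function_remove[OF fin assms(3,4) v, of lam]
    by (simp add: removal_ratio_def field_simps)
qed

lemma removal_ratio_le:
  assumes fin: "finite V" and lam: "lam > 0" and "symp adj" "irreflp adj"
  shows "removal_ratio adj lam V v \<le> 1 + lam"
proof (cases "v \<in> V")
  case True
  have "partition_function (V - {v} - {u. adj v u}) adj lam \<le> partition_function (V - {v}) adj lam"
    using fin lam by (intro partition_function_mono) auto
  moreover have "partition_function (V - {v}) adj lam > 0"
    using fin lam by (simp add: partition_function_pos)
  ultimately show ?thesis
    using partition_function_remove[OF fin assms(3,4) True, of lam] lam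
    by (simp add: removal_ratio_def pos_divide_le_eq algebra_simps)
qed (use assms in \<open>simp add: removal_ratio_not_in\<close>)

section \<open>Conditioning expressed through deletion\<close>

lemma measure_hard_core:
  assumes fin: "finite V" and lam: "lam > 0"
  shows "measure (measure_pmf (hard_core V adj lam)) {I. P I}
    = (\<Sum>I | I \<in> independent_sets V adj \<and> P I. lam ^ card I) / partition_function V adj lam"
proof -
  let ?S = "{I \<in> independent_sets V adj. P I}"
  have "measure (measure_pmf (hard_core V adj lam)) {I. P I}
    = measure (measure_pmf (hard_core V adj lam)) ?S"
    by (rule measure_pmf.finite_measure_eq_AE)
       (auto simp: AE_measure_pmf_iff set_pmf_eq pmf_hard_core[OF fin lam] split: if_splits)
  also have "\<dots> = (\<Sum>I\<in>?S. pmf (hard_core V adj lam) I)"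
    using finite_independent_sets[OF fin] by (intro measure_measure_pmf_finite) simp
  also have "\<dots> = (\<Sum>I\<in>?S. lam ^ card I / partition_function V adj lam)"
    by (rule sum.cong) (auto simp: pmf_hard_core[OF fin lam])
  finally show ?thesis
    by (simp add: sum_divide_distrib)
qed

lemma cond_prob_unoccupied:
  assumes fin: "finite V" and lam: "lam > 0" and sym: "symp adj"
    and B: "B \<in> independent_sets V adj" and v: "v \<notin> B"
  shows "\<P>(I in measure_pmf (hard_core V adj lam). v \<notin> I \<bar> B \<subseteq> I)
    = 1 / removal_ratio adj lam (V - B - {u. \<exists>b\<in>B. adj b u}) v"
proof -
  have B': "B \<in> independent_sets (V - {v}) adj"
    using B v by (auto simp: independent_sets_def)
  have "{I. I \<in> independent_sets V adj \<and> v \<notin> I \<and> B \<subseteq> I}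
    = {I. I \<in> independent_sets (V - {v}) adj \<and> B \<subseteq> I}"
    by (auto simp: independent_sets_def)
  moreover have "V - {v} - B - {u. \<exists>b\<in>B. adj b u} = V - B - {u. \<exists>b\<in>B. adj b u} - {v}"
    by auto
  ultimately have "(\<Sum>I | I \<in> independent_sets V adj \<and> v \<notin> I \<and> B \<subseteq> I. lam ^ card I)
    = lam ^ card B * partition_function (V - B - {u. \<exists>b\<in>B. adj b u} - {v}) adj lam"
    using sum_independent_sets_containing[OF _ sym B', of lam] fin by simp
  moreover have "partition_function V adj lam > 0"
    using fin lam by (rule partition_function_pos)
  ultimately show ?thesis
    using lam sum_independent_sets_containing[OF fin sym B, of lam]
    by (simp add: cond_prob_def measure_hard_core[OF fin lam] removal_ratio_def)
qed

subsection \<open>Correlation decay on the square lattice\<close>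

text \<open>The derivative \<open>1 / (a * q - b)\<close> is at most 1, because
  \<open>a * q - b \<ge> a - b \<ge> 1\<close>. This starts the induction over the distance to the
  boundary.\<close>

lemma potential_lipschitz:
  assumes "0 < b" "b + 1 \<le> a" "q \<ge> 1" "q' \<ge> 1"
  shows "\<bar>potential a b q - potential a b q'\<bar> \<le> \<bar>q - q'\<bar>"
proof -
  have *: "potential a b x - potential a b y \<le> x - y" if "1 \<le> y" "y \<le> x" for x y
  proof -
    have a: "a > 0" and ay: "a * y \<ge> a" and axy: "a * x \<ge> a * y"
      using assms that by auto
    then have pos: "a * y - b \<ge> 1" "a * x - b \<ge> 1"
      using assms by linarith+
    then have "ln (a * x - b) - ln (a * y - b) \<le> ((a * x - b) - (a * y - b)) / (a * y - b)"
      by (intro ln_diff_le) auto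
    also have "\<dots> \<le> ((a * x - b) - (a * y - b)) / 1"
      using pos axy by (intro divide_left_mono) auto
    finally have "(ln (a * x - b) - ln (a * y - b)) / a \<le> x - y"
      using a by (simp only: pos_divide_le_eq) (simp add: algebra_simps)
    then show ?thesis
      by (simp add: potential_def diff_divide_distrib)
  qed
  have mono: "potential a b y \<le> potential a b x" if "1 \<le> y" "y \<le> x" for x y
  proof -
    have a: "a > 0" and "a * y \<ge> a" "a * x \<ge> a * y"
      using assms that by auto
    then have "ln (a * y - b) \<le> ln (a * x - b)"
      using assms by (intro ln_mono) linarith+
    then show ?thesis
      using a by (simp add: potential_def divide_right_mono)
  qed
  show ?thesis
    using *[of q q'] *[of q' q] mono[of q q'] mono[of q' q] assms by linarith
qed

text \<open>The derivative is at least \<open>1 / (a * M)\<close> on \<open>[1, M]\<close>. This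
  turns decay of potentials back into decay of ratios.\<close>

lemma potential_expanding:
  assumes ab: "0 < b" "b < a" and q: "1 \<le> q" "q \<le> M" and q': "1 \<le> q'" "q' \<le> M"
  shows "\<bar>q - q'\<bar> \<le> a * M * \<bar>potential a b q - potential a b q'\<bar>"
proof -
  have *: "x - y \<le> a * M * (potential a b x - potential a b y)" if "1 \<le> y" "y \<le> x" "x \<le> M" for x y
  proof -
    have a: "a > 0" and "a * y \<ge> a" and axy: "a * x \<ge> a * y" and aM: "a * x \<le> a * M"
      using ab that by auto
    then have pos: "a * y - b > 0" "a * x - b > 0"
      using ab by linarith+
    then have "ln (a * y - b) - ln (a * x - b) \<le> ((a * y - b) - (a * x - b)) / (a * x - b)"
      by (intro ln_diff_le)
    then have "(a * x - a * y) / (a * x - b) \<le> ln (a * x - b) - ln (a * y - b)"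
      by (simp add: diff_divide_distrib)
    moreover have "(a * x - a * y) / (a * M) \<le> (a * x - a * y) / (a * x - b)"
    proof (rule divide_left_mono)
      show "a * x - b \<le> a * M"
        using aM ab by linarith
      then show "0 < a * M * (a * x - b)"
        using pos a that by (intro mult_pos_pos) linarith+
    qed (use axy in simp)
    moreover have "(x - y) / M = (a * x - a * y) / (a * M)"
      using a by (simp add: right_diff_distrib[symmetric])
    ultimately have "(x - y) / M \<le> a * (potential a b x - potential a b y)"
      using a by (simp add: potential_def right_diff_distrib)
    then show ?thesis
      using that by (simp add: pos_divide_le_eq mult_ac)
  qed
  have "\<bar>x - y\<bar> \<le> a * M * \<bar>potential a b x - potential a b y\<bar>"
    if "1 \<le> y" "y \<le> x" "x \<le> M" for x y
  proof -
    have "a * M * (potential a b x - potential a b y) \<le> a * M * \<bar>potential a b x - potential a b y\<bar>"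
      using ab that by (intro mult_left_mono) auto
    then show ?thesis
      using *[OF that] that by linarith
  qed
  from this[of q' q] this[of q q'] show ?thesis
    using q q' by (cases "q \<le> q'") (simp_all add: abs_minus_commute)
qed

section \<open>Lattice distance and automorphisms\<close>

definition lattice_dist :: "int \<times> int \<Rightarrow> int \<times> int \<Rightarrow> int" where
  "lattice_dist u v = \<bar>fst u - fst v\<bar> + \<bar>snd u - snd v\<bar>"

lemma lattice_adj_iff_dist: "lattice_adj u v \<longleftrightarrow> lattice_dist u v = 1"
  by (simp add: lattice_adj_def lattice_dist_def)

lemma lattice_dist_triangle: "lattice_dist u w \<le> lattice_dist u v + lattice_dist v w"
  unfolding lattice_dist_def by linarith

lemma lattice_dist_self [simp]: "lattice_dist u u = 0"
  by (simp add: lattice_dist_def)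

lemma symp_lattice_adj: "symp lattice_adj"
  by (auto simp: symp_def lattice_adj_def)

lemma irreflp_lattice_adj: "irreflp lattice_adj"
  by (auto simp: irreflp_def lattice_adj_def)

lemma lattice_adj_origin: "lattice_adj (0, 0) e \<longleftrightarrow> e \<in> {(1, 0), (-1, 0), (0, 1), (0, -1)}"
  by (cases e) (auto simp: lattice_adj_def)

definition lattice_aut :: "(int \<times> int \<Rightarrow> int \<times> int) \<Rightarrow> bool" where
  "lattice_aut f \<longleftrightarrow> bij f \<and> (\<forall>u v. lattice_adj (f u) (f v) \<longleftrightarrow> lattice_adj u v)"

lemma lattice_aut_adj: "lattice_aut f \<Longrightarrow> lattice_adj (f u) (f v) \<longleftrightarrow> lattice_adj u v"
  unfolding lattice_aut_def by blast

lemma lattice_aut_id: "lattice_aut id"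
  by (simp add: lattice_aut_def)

lemma lattice_aut_comp: "lattice_aut f \<Longrightarrow> lattice_aut g \<Longrightarrow> lattice_aut (f \<circ> g)"
  unfolding lattice_aut_def by (metis bij_comp comp_apply)

text \<open>
  A lattice automorphism taking the origin to \<open>e\<close> and the direction \<open>(1, 0)\<close> to \<open>e\<close> (provided that
  \<open>e\<close> is a unit vector), so that in the new frame the previous vertex is \<open>(-1, 0)\<close>.
\<close>

definition turn :: "int \<times> int \<Rightarrow> int \<times> int \<Rightarrow> int \<times> int" where
  "turn e p = (fst e + fst e * fst p + \<bar>snd e\<bar> * snd p, snd e + snd e * fst p + \<bar>fst e\<bar> * snd p)"

lemma turn_origin: "turn e (0, 0) = e"
  by (simp add: turn_def)

lemma lattice_aut_turn:
  assumes "lattice_adj (0, 0) e"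
  shows "lattice_aut (turn e)"
  unfolding lattice_aut_def
proof
  consider "e = (1, 0)" | "e = (-1, 0)" | "e = (0, 1)" | "e = (0, -1)"
    using assms by (auto simp: lattice_adj_origin)
  then show "bij (turn e)"
  proof cases
    case 1
    then show ?thesis
      by (intro bij_betw_byWitness[where f' = "\<lambda>(x, y). (x - 1, y)"]) (auto simp: turn_def)
  next
    case 2
    then show ?thesis
      by (intro bij_betw_byWitness[where f' = "\<lambda>(x, y). (- 1 - x, y)"]) (auto simp: turn_def)
  next
    case 3
    then show ?thesis
      by (intro bij_betw_byWitness[where f' = "\<lambda>(x, y). (y - 1, x)"]) (auto simp: turn_def)
  next
    case 4
    then show ?thesis
      by (intro bij_betw_byWitness[where f' = "\<lambda>(x, y). (- 1 - y, x)"]) (auto simp: turn_def)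
  qed
  show "\<forall>u v. lattice_adj (turn e u) (turn e v) \<longleftrightarrow> lattice_adj u v"
    using assms unfolding lattice_adj_origin
    by (auto simp: turn_def lattice_adj_def abs_minus_commute add.commute)
qed

text \<open>
  A template records a set of vertices, relative to the current vertex at the origin, that are known
  to have been deleted, together with the parameters \<open>a\<close> (\<open>top\<close>) and \<open>b\<close> (\<open>slope\<close>) of its
  potential. A branch \<open>(e, j)\<close> says that the neighbour \<open>e\<close>, after deletion of the origin and of the
  neighbours listed before it, fits template number \<open>j\<close> seen through \<open>turn e\<close>. The order of the
  branches matters: a good order leaves more deleted vertices near the later neighbours.
\<close>

datatype template = Template (removed: "(int \<times> int) list") (top: real) (slope: real)
  (branches: "((int \<times> int) \<times> nat) list")

text \<open>
  The table was found by numerical optimisation: shapes were taken from the vertices at Euclidean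
  distance at most \<open>sqrt 5\<close>, discarded greedily, and the potentials scaled and rounded to integers.
  Several templates share one shape, which may be used with different potentials.
\<close>

definition templates :: "template list" where
  "templates =
   [Template [] 1524 1097 [((1, 0), 1), ((0, 1), 1), ((-1, 0), 2), ((0, -1), 2)],
    Template [(-1, 0)] 1224 882 [((1, 0), 2), ((0, 1), 1), ((0, -1), 2)],
    Template [(-2, 0), (-1, 0)] 1000 718 [((1, 0), 2), ((0, 1), 9), ((0, -1), 9)],
    Template [(-2, -1), (-2, 0), (-1, 0)] 978 723 [((1, 0), 2), ((0, 1), 9), ((0, -1), 11)],
    Template [(-1, 0), (-1, 1), (0, -1)] 790 683 [((1, 0), 8), ((0, 1), 7)],
    Template [(-2, 1), (-1, -1), (-1, 0)] 855 597 [((1, 0), 3), ((0, 1), 11), ((0, -1), 4)],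
    Template [(-2, -1), (-2, 1), (-1, 0)] 888 618 [((1, 0), 2), ((0, 1), 11), ((0, -1), 11)],
    Template [(-1, 0), (-1, 1), (0, -1)] 573 294 [((1, 0), 5), ((0, 1), 4)],
    Template [(-2, 1), (-1, -1), (-1, 0)] 714 360 [((1, 0), 3), ((0, 1), 11), ((0, -1), 4)],
    Template [(-1, -2), (-1, -1), (-1, 0), (-1, 1)] 873 668 [((1, 0), 6), ((0, -1), 12), ((0, 1), 4)],
    Template [(-1, 0), (-1, 1), (0, -1)] 657 450 [((1, 0), 8), ((0, 1), 10)],
    Template [(-1, -1), (-1, 0), (-1, 1), (0, -2)] 813 677 [((1, 0), 13), ((0, 1), 10), ((0, -1), 14)],
    Template [(-1, 0), (-1, 1), (0, -1), (1, -1)] 719 606 [((1, 0), 17), ((0, 1), 10)],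
    Template [(-2, -1), (-2, 1), (-1, -2), (-1, 0)] 775 445 [((1, 0), 2), ((0, 1), 11), ((0, -1), 18)],
    Template [(-1, 0), (-1, 1), (0, -1), (1, 0)] 414 408 [((0, 1), 16)],
    Template [(-2, 1), (-1, 0), (0, -1)] 689 419 [((1, 0), 2), ((0, 1), 11)],
    Template [(-1, 0), (-1, 1), (0, -1)] 428 21 [((1, 0), 5), ((0, 1), 4)],
    Template [(-2, 1), (-1, -1), (-1, 0), (0, -1)] 629 333 [((1, 0), 3), ((0, 1), 11)],
    Template [(-1, -1), (-1, 0), (-1, 1), (0, -2), (1, -1)] 784 669
      [((1, 0), 15), ((0, 1), 10), ((0, -1), 14)]]"

abbreviation rate :: real where "rate \<equiv> 1999 / 2000"

definition branch :: "template \<Rightarrow> nat \<Rightarrow> template" where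
  "branch t i = templates ! snd (branches t ! i)"

text \<open>Inclusion instead of equality in the last condition lets a branch forget deleted
  vertices, which is what closes the recursion on a finite table.\<close>

definition covered :: "template \<Rightarrow> bool" where
  "covered t \<longleftrightarrow>
     {(1, 0), (-1, 0), (0, 1), (0, -1)} \<subseteq> set (removed t) \<union> fst ` set (branches t) \<and>
     (\<forall>i<length (branches t).
        fst (branches t ! i) \<in> {(1, 0), (-1, 0), (0, 1), (0, -1)} \<and>
        snd (branches t ! i) < length templates \<and>
        turn (fst (branches t ! i)) ` set (removed (branch t i))
          \<subseteq> insert (0, 0) (set (removed t) \<union> fst ` set (take i (branches t))))"

text \<open>The inequality is the hypothesis \<open>bound\<close> of
  \<open>potential_contraction\<close> at the largest activity treated; the gap of 1 between
  \<open>slope\<close> and \<open>top\<close> serves \<open>potential_lipschitz\<close>.\<close>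

definition contracting :: "template \<Rightarrow> bool" where
  "contracting t \<longleftrightarrow> 0 < slope t \<and> slope t + 1 \<le> top t \<and>
     2481 / 1000 * ((\<Sum>i<length (branches t). top (branch t i)) - rate * top t) ^ Suc (length (branches t))
       \<le> real (Suc (length (branches t))) ^ Suc (length (branches t)) * (rate * (top t - slope t))
         * (\<Prod>i<length (branches t). slope (branch t i))"

lemma templates_covered: "\<forall>t\<in>set templates. covered t"
  unfolding templates_def
  by (simp add: covered_def branch_def templates_def turn_def All_less_Suc2)

lemma templates_contracting: "\<forall>t\<in>set templates. contracting t"
  unfolding templates_def
  by (simp add: contracting_def branch_def templates_def)

section \<open>Decay along the templates\<close>

lemma lattice_aut_neighbour:
  assumes "lattice_aut f" "lattice_adj (f (0, 0)) u"
  obtains e where "lattice_adj (0, 0) e" "u = f e"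
  using assms unfolding lattice_aut_def by (metis bij_pointE)

abbreviation ratio :: "real \<Rightarrow> (int \<times> int) set \<Rightarrow> int \<times> int \<Rightarrow> real" where
  "ratio \<equiv> removal_ratio lattice_adj"

abbreviation template_potential :: "template \<Rightarrow> real \<Rightarrow> real" where
  "template_potential t \<equiv> potential (top t) (slope t)"

text \<open>The check at \<open>2481 / 1000\<close> covers all smaller activities: the left side
  grows with \<open>lam\<close> if the power is nonnegative, and otherwise is at most 0 while the
  right side is nonnegative.\<close>

lemma contracting_bound:
  assumes "contracting t" "0 < lam" "lam \<le> 2481 / 1000" and pos: "\<And>i. i < length (branches t) \<Longrightarrow> slope (branch t i) > 0"
  shows "lam * ((\<Sum>i<length (branches t). top (branch t i)) - rate * top t) ^ Suc (length (branches t))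
       \<le> real (Suc (length (branches t))) ^ Suc (length (branches t)) * (rate * (top t - slope t))
         * (\<Prod>i<length (branches t). slope (branch t i))" (is "lam * ?E \<le> ?R")
proof (cases "?E \<ge> 0")
  case True
  then have "lam * ?E \<le> 2481 / 1000 * ?E"
    using assms by (intro mult_right_mono)
  then show ?thesis
    using assms unfolding contracting_def by linarith
next
  case False
  then have "lam * ?E \<le> 0"
    using assms by (intro mult_nonneg_nonpos) auto
  also have "0 \<le> ?R"
    using assms unfolding contracting_def by (intro mult_nonneg_nonneg prod_nonneg) (auto simp: less_imp_le)
  finally show ?thesis .
qed

text \<open>Here \<open>n\<close> is a radius within which \<open>V\<close> and \<open>V'\<close>
  agree. Each step of the recursion moves to a neighbour, uses up one unit of the radius and gains a
  factor \<open>rate\<close>. At radius 0 both ratios lie in \<open>[1, 1 + lam]\<close>.\<close>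

lemma template_potential_contraction:
  assumes lam: "0 < lam" "lam \<le> 2481 / 1000"
    and "t \<in> set templates" "lattice_aut f" "finite V" "finite V'"
    and "V \<inter> f ` set (removed t) = {}" "V' \<inter> f ` set (removed t) = {}"
    and "\<And>w. lattice_dist (f (0, 0)) w \<le> int n \<Longrightarrow> w \<in> V \<longleftrightarrow> w \<in> V'"
  shows "\<bar>template_potential t (ratio lam V (f (0, 0))) - template_potential t (ratio lam V' (f (0, 0)))\<bar>
    \<le> rate ^ n * lam"
  using assms(3-)
proof (induction n arbitrary: t f V V')
  case 0
  have "contracting t"
    using templates_contracting 0 by blast
  then have "\<bar>template_potential t (ratio lam V (f (0, 0))) - template_potential t (ratio lam V' (f (0, 0)))\<bar>
    \<le> \<bar>ratio lam V (f (0, 0)) - ratio lam V' (f (0, 0))\<bar>"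
    using removal_ratio_ge_1 lam 0 by (intro potential_lipschitz) (auto simp: contracting_def)
  also have "\<dots> \<le> lam"
    using removal_ratio_ge_1[of V lam lattice_adj "f (0, 0)"] removal_ratio_ge_1[of V' lam lattice_adj "f (0, 0)"]
      removal_ratio_le[of V lam lattice_adj "f (0, 0)"] removal_ratio_le[of V' lam lattice_adj "f (0, 0)"]
      lam 0 symp_lattice_adj irreflp_lattice_adj by (simp add: abs_le_iff)
  finally show ?case
    by simp
next
  case (Suc n)
  define v where "v = f (0, 0)"
  define us where "us = map (f \<circ> fst) (branches t)"
  define d where "d = length (branches t)"
  have t: "covered t" "contracting t"
    using templates_covered templates_contracting Suc.prems(1) by blast+
  have dist_step: "lattice_dist v w \<le> int (Suc n)"
    if "lattice_adj (0, 0) e" "lattice_dist (f e) w \<le> int n" for e w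
  proof -
    have "lattice_adj v (f e)"
      using that Suc.prems(2) by (simp add: lattice_aut_adj v_def)
    then show ?thesis
      using that lattice_dist_triangle[of v w "f e"] by (simp add: lattice_adj_iff_dist)
  qed
  show ?case
  proof (cases "v \<in> V")
    case False
    then have "v \<notin> V'"
      using Suc.prems(7)[of v] by (simp add: v_def)
    with False show ?thesis
      using Suc.prems lam unfolding v_def by (simp add: removal_ratio_not_in)
  next
    case True
    then have "v \<in> V'"
      using Suc.prems(7)[of v] by (simp add: v_def)
    define R where "R = (\<lambda>W i. ratio lam (W - {v} - set (take i us)) (us ! i))"
    have e: "lattice_adj (0, 0) (fst (branches t ! i))" if "i < d" for i
      using t(1) that unfolding covered_def d_def lattice_adj_origin by blast
    have branch_in: "branch t i \<in> set templates" if "i < d" for i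
      using t(1) that unfolding covered_def d_def branch_def by simp
    have us_nth: "us ! i = f (fst (branches t ! i))" if "i < d" for i
      using that by (simp add: us_def d_def)
    have us_adj: "set us \<subseteq> {u. lattice_adj v u}"
    proof
      fix u assume "u \<in> set us"
      then obtain i where "i < d" "u = us ! i"
        by (auto simp: in_set_conv_nth us_def d_def)
      then show "u \<in> {u. lattice_adj v u}"
        using e us_nth Suc.prems(2) by (simp add: lattice_aut_adj v_def)
    qed
    have rec: "ratio lam W v = 1 + lam * (\<Prod>i<d. 1 / R W i)"
      if W: "finite W" "v \<in> W" "W \<inter> f ` set (removed t) = {}" for W
    proof -
      have "{u \<in> W. lattice_adj v u} \<subseteq> set us"
      proof clarify
        fix x y assume u: "(x, y) \<in> W" "lattice_adj v (x, y)"
        then obtain e where e: "lattice_adj (0, 0) e" "(x, y) = f e"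
          using lattice_aut_neighbour[OF Suc.prems(2)] unfolding v_def by blast
        then have "e \<in> set (removed t) \<union> fst ` set (branches t)"
          using t(1) unfolding covered_def lattice_adj_origin by blast
        moreover have "e \<notin> set (removed t)"
          using W u e by auto
        ultimately show "(x, y) \<in> set us"
          using e by (auto simp: us_def)
      qed
      from removal_ratio_rec[OF W(1) lam(1) symp_lattice_adj irreflp_lattice_adj W(2) us_adj this]
      show ?thesis
        by (simp add: R_def us_def d_def)
    qed
    have IH: "\<bar>template_potential (branch t i) (R V i) - template_potential (branch t i) (R V' i)\<bar>
        \<le> rate ^ n * lam" if i: "i < d" for i
    proof -
      \<comment> \<open>The frame of the branch: its origin is the neighbour \<open>us ! i\<close>,
        and the template of the branch is read through it.\<close>
      define g where "g = f \<circ> turn (fst (branches t ! i))"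
      have g: "lattice_aut g" "g (0, 0) = us ! i"
        using Suc.prems(2) e[OF i] us_nth[OF i]
        by (auto simp: g_def turn_origin intro: lattice_aut_comp lattice_aut_turn)
      have "turn (fst (branches t ! i)) ` set (removed (branch t i))
          \<subseteq> insert (0, 0) (set (removed t) \<union> fst ` set (take i (branches t)))"
        using t(1) i unfolding covered_def d_def by blast
      then have "g ` set (removed (branch t i))
          \<subseteq> f ` insert (0, 0) (set (removed t) \<union> fst ` set (take i (branches t)))"
        unfolding g_def image_comp[symmetric] by (rule image_mono)
      also have "\<dots> = insert v (f ` set (removed t) \<union> set (take i us))"
        by (simp add: v_def us_def image_Un take_map image_comp)
      finally have disj: "(W - {v} - set (take i us)) \<inter> g ` set (removed (branch t i)) = {}"
        if "W \<inter> f ` set (removed t) = {}" for W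
        using that by blast
      \<comment> \<open>The same vertices are deleted on both sides, and the ball of radius
        \<open>n\<close> around the neighbour lies in the ball of radius \<open>n + 1\<close> around
        \<open>v\<close>.\<close>
      have "w \<in> V - {v} - set (take i us) \<longleftrightarrow> w \<in> V' - {v} - set (take i us)"
        if "lattice_dist (g (0, 0)) w \<le> int n" for w
        using Suc.prems(7)[of w] dist_step[OF e[OF i], of w] that g(2) us_nth[OF i] by (simp add: v_def)
      from Suc.IH[OF branch_in[OF i] g(1) _ _ disj disj this] Suc.prems
      show ?thesis
        by (simp add: R_def g(2))
    qed
    have "\<bar>template_potential t (1 + lam * (\<Prod>i<d. 1 / R V i)) - template_potential t (1 + lam * (\<Prod>i<d. 1 / R V' i))\<bar>
      \<le> rate * (rate ^ n * lam)"
    proof (rule potential_contraction)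
      show "0 < slope (branch t i) \<and> slope (branch t i) < top (branch t i)" if "i \<in> {..<d}" for i
        using templates_contracting branch_in[of i] that by (fastforce simp: contracting_def)
      then show "lam * ((\<Sum>i<d. top (branch t i)) - rate * top t) ^ Suc (card {..<d})
        \<le> real (Suc (card {..<d})) ^ Suc (card {..<d}) * (rate * (top t - slope t)) * (\<Prod>i<d. slope (branch t i))"
        using contracting_bound[OF t(2) lam] by (simp add: d_def)
      show "0 \<le> slope t" "slope t < top t"
        using t(2) by (auto simp: contracting_def)
      show "1 \<le> R V i" "1 \<le> R V' i" for i
        using Suc.prems lam by (auto simp: R_def intro!: removal_ratio_ge_1)
      show "\<bar>template_potential (branch t i) (R V i) - template_potential (branch t i) (R V' i)\<bar>
        \<le> rate ^ n * lam" if "i \<in> {..<d}" for i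
        using IH that by simp
    qed (use lam in auto)
    then show ?thesis
      using rec[of V] rec[of V'] True \<open>v \<in> V'\<close> Suc.prems by (simp add: v_def[symmetric] mult.assoc)
  qed
qed

subsection \<open>Uniqueness\<close>

definition parity_boundary :: "nat \<Rightarrow> bool \<Rightarrow> (int \<times> int) set" where
  "parity_boundary L p = {(x, y) \<in> lattice_box_boundary L. even (x + y) = p}"

lemma p_even_eq: "p_even lam L = unoccupied_prob lam L (parity_boundary L True)"
  by (simp add: p_even_def parity_boundary_def)

lemma p_odd_eq: "p_odd lam L = unoccupied_prob lam L (parity_boundary L False)"
  by (simp add: p_odd_def parity_boundary_def)

text \<open>Adjacent vertices have opposite parities, so the conditioned set is independent;
  \<open>L > 0\<close> keeps the origin off the boundary.\<close>

lemma unoccupied_prob_parity: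
  fixes p :: bool
  assumes "0 < lam" "L > 0"
  defines "B \<equiv> parity_boundary L p"
  shows "unoccupied_prob lam L B
    = 1 / ratio lam (lattice_box L - B - {u. \<exists>b\<in>B. lattice_adj b u}) (0, 0)"
  unfolding unoccupied_prob_def
proof (rule cond_prob_unoccupied)
  have "\<not> lattice_adj u w" if "u \<in> B" "w \<in> B" for u w
  proof
    assume "lattice_adj u w"
    then have "odd (\<bar>fst u - fst w\<bar> + \<bar>snd u - snd w\<bar>)"
      by (simp add: lattice_adj_def)
    then have "odd ((fst u + snd u) + (fst w + snd w))"
      by (simp add: algebra_simps) presburger
    then show False
      using that by (auto simp: B_def parity_boundary_def)
  qed
  then show "B \<in> independent_sets (lattice_box L) lattice_adj"
    by (auto simp: independent_sets_def B_def parity_boundary_def lattice_box_boundary_def)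
  show "(0, 0) \<notin> B"
    using assms by (auto simp: parity_boundary_def lattice_box_boundary_def)
qed (use assms symp_lattice_adj in \<open>auto simp: lattice_box_def\<close>)

text \<open>Boundary vertices of the box of size \<open>n + 2\<close> are at distance at least
  \<open>n + 2\<close> from the origin and their neighbours at least \<open>n + 1\<close>, so the
  ball of radius \<open>n\<close> is untouched under either parity.\<close>

lemma parity_boundary_complement:
  fixes p :: bool
  assumes "lattice_dist (0, 0) w \<le> int n"
  defines "B \<equiv> parity_boundary (n + 2) p"
  shows "w \<in> lattice_box (n + 2) - B - {u. \<exists>b\<in>B. lattice_adj b u}"
proof -
  obtain x y where w: "w = (x, y)"
    by (cases w)
  have b: "lattice_dist (0, 0) b \<ge> int n + 2" if "b \<in> B" for b
    using that by (auto simp: B_def parity_boundary_def lattice_box_boundary_def lattice_dist_def)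
  have "\<not> lattice_adj b w" if "b \<in> B" for b
    using b[OF that] assms(1) lattice_dist_triangle[of "(0, 0)" b w]
    by (auto simp: lattice_adj_def lattice_dist_def abs_minus_commute)
  moreover have "w \<notin> B"
    using b[of w] assms(1) by auto
  ultimately show ?thesis
    using assms(1) by (auto simp: w lattice_box_def lattice_dist_def)
qed

lemma p_odd_even_bound:
  assumes lam: "0 < lam" "lam \<le> 2481 / 1000"
  shows "\<exists>C. \<forall>n. \<bar>p_odd lam (n + 2) - p_even lam (n + 2)\<bar> \<le> C * rate ^ n"
proof -
  \<comment> \<open>This template has no removed vertices, so it fits the origin in any set.\<close>
  define t where "t = templates ! 0"
  have t: "t \<in> set templates" and removed: "removed t = []"
    by (simp_all add: t_def templates_def)
  then have "contracting t"
    using templates_contracting by blast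
  then have slope: "0 < slope t" "slope t < top t"
    by (auto simp: contracting_def)
  have "\<bar>p_odd lam (n + 2) - p_even lam (n + 2)\<bar> \<le> (top t * (1 + lam) * lam) * rate ^ n" for n
  proof -
    define V where "V = (\<lambda>p. lattice_box (n + 2) - parity_boundary (n + 2) p
      - {u. \<exists>b\<in>parity_boundary (n + 2) p. lattice_adj b u})"
    define q where "q = (\<lambda>p. ratio lam (V p) (0, 0))"
    have fin: "finite (V p)" for p
      by (simp add: V_def lattice_box_def)
    have q: "1 \<le> q p" "q p \<le> 1 + lam" for p
      using removal_ratio_ge_1[OF fin lam(1)] removal_ratio_le[OF fin lam(1) symp_lattice_adj irreflp_lattice_adj]
      by (auto simp: q_def)
    have "p_even lam (n + 2) = 1 / q True" "p_odd lam (n + 2) = 1 / q False"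
      using unoccupied_prob_parity[OF lam(1), of "n + 2"]
      by (simp_all add: p_even_eq p_odd_eq q_def V_def)
    then have "\<bar>p_odd lam (n + 2) - p_even lam (n + 2)\<bar> = \<bar>q True - q False\<bar> / (q True * q False)"
      using q[of True] q[of False] by (simp add: diff_frac_eq abs_mult)
    also have "\<dots> \<le> \<bar>q True - q False\<bar> / 1"
      using q[of True] q[of False] mult_mono[of 1 "q True" 1 "q False"]
      by (intro divide_left_mono) auto
    also have "\<dots> \<le> top t * (1 + lam) * \<bar>template_potential t (q True) - template_potential t (q False)\<bar>"
      using potential_expanding[OF slope q q, of True False] by simp
    also have "\<bar>template_potential t (q True) - template_potential t (q False)\<bar> \<le> rate ^ n * lam"
      using template_potential_contraction[OF lam t lattice_aut_id fin fin, of True False n]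
        parity_boundary_complement removed
      by (simp add: q_def V_def)
    finally show ?thesis
      using slope lam by (simp add: mult_left_mono mult_ac)
  qed
  then show ?thesis
    by blast
qed

lemma uniqueness_le:
  assumes "0 < lam" "lam \<le> 2481 / 1000"
  shows "uniqueness lam"
proof -
  obtain C where C: "\<And>n. \<bar>p_odd lam (n + 2) - p_even lam (n + 2)\<bar> \<le> C * rate ^ n"
    using p_odd_even_bound[OF assms] by blast
  have "(\<lambda>n. C * rate ^ n) \<longlonglongrightarrow> C * 0"
    by (intro tendsto_mult_left LIMSEQ_power_zero) simp
  then have "(\<lambda>n. C * rate ^ n) \<longlonglongrightarrow> 0"
    by (simp only: mult_zero_right)
  moreover have "\<forall>\<^sub>F n in sequentially. norm \<bar>p_odd lam (n + 2) - p_even lam (n + 2)\<bar> \<le> C * rate ^ n"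
    unfolding real_norm_def abs_abs by (intro always_eventually allI C)
  ultimately have "(\<lambda>n. \<bar>p_odd lam (n + 2) - p_even lam (n + 2)\<bar>) \<longlonglongrightarrow> 0"
    by (rule Lim_null_comparison[rotated])
  then show ?thesis
    unfolding uniqueness_def by (rule LIMSEQ_offset)
qed

theorem theorem2: "critical_activity > ereal 2.48"
proof -
  \<comment> \<open>The supremum gives only a weak inequality; the margin between 2.481 and 2.48
    makes it strict.\<close>
  have "ereal (2481 / 1000) \<le> critical_activity"
    unfolding critical_activity_def by (rule Sup_upper) (auto intro!: uniqueness_le)
  then show ?thesis
    by (rule less_le_trans[rotated]) simp
qed

end
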